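(* For all integers $n \geq 0$ and all real $x$ and $y$, \begin{align*} B_n(x) & = \sum_{m=0}^n \sum_{l=0}^m (-1)^m m! \genfrac{\{}{\}}{0pt}{}{n}{m}_x\genfrac{\{}{\}}{0pt}{}{m}{l}_y c_{l}(y), \\ B_n(x) & = \sum_{m=0}^n \sum_{l=0}^m m! \genfrac{\{}{\}}{0pt}{}{n}{m}_x\genfrac{\{}{\}}{0pt}{}{m}{l}_y \widehat{c}_{l}(-y), \\ c_n(x) & = \sum_{m=0}^n \sum_{l=0}^m \frac{(-1)^{n-m+l}}{m!} \genfrac{[}{]}{0pt}{}{n}{m}_x\genfrac{[}{]}{0pt}{}{m}{l}_y B_{l}(y), \\ \widehat{c}_n(-x) & = \sum_{m=0}^n \sum_{l=0}^m \frac{(-1)^{n-l}}{m!} \genfrac{[}{]}{0pt}{}{n}{m}_x\genfrac{[}{]}{0pt}{}{m}{l}_y B_{l}(y). \end{align*}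
   Context: For real $z$ and integer $n\ge 0$, $\binom{z}{n} = \frac{z(z-1)\cdots(z-n+1)}{n!}$. The Cauchy polynomials of the first and second kind are $c_n(x) = n! \int_{0}^{1} \binom{t - x}{n}\, dt$ and $\widehat{c}_n(x) = n! \int_{0}^{1} \binom{x - t}{n}\, dt$, $n \ge 0$. $B_n(x)$ are the classical Bernoulli polynomials, $\frac{te^{xt}}{e^t-1}=\sum_{n\ge0}B_n(x)\frac{t^n}{n!}$. For $0\le m\le n$ and $x \in\mathbb{R}$, the generalized Stirling numbers of the first and second kind are $\genfrac{[}{]}{0pt}{}{n}{m}_x = \sum_{i=0}^{n-m} \binom{i+m}{m}\genfrac{[}{]}{0pt}{}{n}{i+m} x^i$ and $\genfrac{\{}{\}}{0pt}{}{n}{m}_x = \sum_{i=0}^{n-m} \binom{n}{i}\genfrac{\{}{\}}{0pt}{}{n-i}{m} x^i$, where $\genfrac{[}{]}{0pt}{}{n}{m}$ are the unsigned Stirling numbers of the first kind, $\genfrac{\{}{\}}{0pt}{}{n}{m}$ are the Stirling numbers of the second kind, and $x^0=1$. *)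

theory Defs
  imports
    "HOL-Analysis.Analysis"
    "HOL-Combinatorics.Stirling"
    "HOL-Computational_Algebra.Formal_Power_Series"
begin

definition cauchy1 :: "nat \<Rightarrow> real \<Rightarrow> real" where
  "cauchy1 n x = fact n * integral {0..1} (\<lambda>t. (t - x) gchoose n)"

definition cauchy2 :: "nat \<Rightarrow> real \<Rightarrow> real" where
  "cauchy2 n x = fact n * integral {0..1} (\<lambda>t. (x - t) gchoose n)"

definition bernoulli_egf :: "real \<Rightarrow> real fps" where
  "bernoulli_egf x = fps_X * fps_exp x / (fps_exp 1 - 1)"

(* The denominator has constant term 0, so this is an exact division of power
   series and not multiplication by an inverse; the lemma shows it is exact. *)
lemma bernoulli_egf_mult: "bernoulli_egf x * (fps_exp 1 - 1) = fps_X * fps_exp x"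
proof -
  have nz: "fps_exp 1 - 1 \<noteq> (0 :: real fps)"
  proof
    assume "fps_exp 1 - 1 = (0 :: real fps)"
    then have "fps_nth (fps_exp 1 - 1 :: real fps) 1 = 0" by simp
    then show False by simp
  qed
  have "subdegree (fps_exp 1 - 1 :: real fps) = 1"
    by (rule subdegreeI) auto
  moreover have "subdegree (fps_X * fps_exp x) = 1"
    by (rule subdegreeI) auto
  ultimately have "(fps_exp 1 - 1) dvd (fps_X * fps_exp x)"
    using nz by (subst fps_dvd_iff) auto
  then show ?thesis
    unfolding bernoulli_egf_def by (rule dvd_div_mult_self)
qed

definition bernoulli_poly :: "nat \<Rightarrow> real \<Rightarrow> real" where
  "bernoulli_poly n x = fact n * fps_nth (bernoulli_egf x) n"

(* Intended for m \<le> n. The library's stirling is the unsigned first kind,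
   Stirling the second kind. *)
definition gen_stirling1 :: "nat \<Rightarrow> nat \<Rightarrow> real \<Rightarrow> real" where
  "gen_stirling1 n m x =
     (\<Sum>i = 0..n - m. real ((i + m) choose m) * real (stirling n (i + m)) * x ^ i)"

definition gen_stirling2 :: "nat \<Rightarrow> nat \<Rightarrow> real \<Rightarrow> real" where
  "gen_stirling2 n m x =
     (\<Sum>i = 0..n - m. real (n choose i) * real (Stirling (n - i) m) * x ^ i)"

end

theory Submission
  imports Defs
begin

text \<open>
  Everything reduces to four single sums. The generalized Stirling numbers change basis between
  powers and shifted factorials,
  \[ \sum_m {n \brack m}_x z^m = (x+z)(x+z+1)\cdots(x+z+n-1), \qquad
     \sum_l {m \brace l}_y\, l! {z \choose l} = (z+y)^m, \]
  so integrating over $[0,1]$ evaluates the inner Cauchy sums to $\pm 1/(m+1)$ and expands the Cauchy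
  polynomials in the ${n \brack m}_x/(m+1)$. Writing $t = \ln(1+(e^t-1))$ in the generating function
  of the Bernoulli polynomials gives $B_n(x) = \sum_m {n \brace m}_x (-1)^m m!/(m+1)$, and
  inverting this by the orthogonality of the two kinds of numbers evaluates the inner Bernoulli sums.
\<close>

section \<open>Generalized Stirling numbers as change-of-basis coefficients\<close>

text \<open>Substituting \<open>k = i + m\<close> and padding with terms \<open>k < m\<close>, where
  \<open>k choose m\<close> is zero, gives a summation range independent of \<open>m\<close>; this
  allows sums over \<open>m\<close> and \<open>k\<close> to be exchanged.\<close>

lemma gen_stirling1_altdef:
  assumes "m \<le> n"
  shows "gen_stirling1 n m x = (\<Sum>k\<le>n. real (k choose m) * real (stirling n k) * x ^ (k - m))"
proof -
  have "gen_stirling1 n m x = (\<Sum>k=m..n. real (k choose m) * real (stirling n k) * x ^ (k - m))"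
    unfolding gen_stirling1_def using assms
    by (intro sum.reindex_bij_witness[of _ "\<lambda>k. k - m" "\<lambda>i. i + m"]) auto
  also have "\<dots> = (\<Sum>k\<le>n. real (k choose m) * real (stirling n k) * x ^ (k - m))"
    by (intro sum.mono_neutral_left) auto
  finally show ?thesis .
qed

text \<open>After exchanging the sums, the inner sum over \<open>m\<close> is the binomial expansion
  of \<open>(x + z) ^ k\<close>, and the ordinary first-kind numbers convert powers of
  \<open>x + z\<close> into a rising factorial.\<close>

lemma sum_gen_stirling1_power:
  "(\<Sum>m=0..n. gen_stirling1 n m x * z ^ m) = pochhammer (x + z) n"
proof -
  have "(\<Sum>m=0..n. gen_stirling1 n m x * z ^ m) =
      (\<Sum>m\<le>n. \<Sum>k\<le>n. real (k choose m) * real (stirling n k) * x ^ (k - m) * z ^ m)"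
    by (intro sum.cong) (auto simp: gen_stirling1_altdef sum_distrib_right)
  also have "\<dots> = (\<Sum>k\<le>n. \<Sum>m\<le>n. real (k choose m) * real (stirling n k) * x ^ (k - m) * z ^ m)"
    by (rule sum.swap)
  also have "\<dots> = (\<Sum>k\<le>n. real (stirling n k) * (x + z) ^ k)"
  proof (intro sum.cong refl)
    fix k assume k: "k \<in> {..n}"
    have "(\<Sum>m\<le>n. real (k choose m) * real (stirling n k) * x ^ (k - m) * z ^ m) =
        (\<Sum>m\<le>k. real (k choose m) * real (stirling n k) * x ^ (k - m) * z ^ m)"
      using k by (intro sum.mono_neutral_right) auto
    also have "\<dots> = real (stirling n k) * (z + x) ^ k"
      by (simp add: binomial_ring sum_distrib_left mult_ac)
    finally show "(\<Sum>m\<le>n. real (k choose m) * real (stirling n k) * x ^ (k - m) * z ^ m) =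
        real (stirling n k) * (x + z) ^ k"
      by (simp add: add.commute)
  qed
  also have "\<dots> = pochhammer (x + z) n"
    by (rule stirling_pochhammer)
  finally show ?thesis .
qed

text \<open>The added terms have \<open>n - i < m\<close>, so their Stirling number is zero. Again
  the range no longer depends on \<open>m\<close>.\<close>

lemma gen_stirling2_altdef:
  "gen_stirling2 n m x = (\<Sum>i\<le>n. real (n choose i) * real (Stirling (n - i) m) * x ^ i)"
  unfolding gen_stirling2_def
  by (intro sum.mono_neutral_left) auto

text \<open>With f(k) = k! (z gchoose k), the falling factorial, f(k+1) = (z - k) f(k). The
  recurrence of the Stirling numbers contributes k f(k) + f(k+1) = z f(k), so each step multiplies
  the sum by \<open>z\<close>.\<close>

lemma sum_Stirling_gbinomial:
  "(\<Sum>k\<le>n. real (Stirling n k) * (fact k * (z gchoose k))) = z ^ n"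
proof (induction n)
  case 0
  show ?case by simp
next
  case (Suc n)
  let ?f = "\<lambda>k. fact k * (z gchoose k) :: real"
  have f_Suc: "?f (Suc k) = (z - real k) * ?f k" for k
    using gbinomial_mult_1[of z k] by (simp add: algebra_simps)
  have "(\<Sum>k\<le>Suc n. real (Stirling (Suc n) k) * ?f k) =
      (\<Sum>k\<le>n. real (Suc k) * real (Stirling n (Suc k)) * ?f (Suc k)) +
      (\<Sum>k\<le>n. real (Stirling n k) * ?f (Suc k))"
    by (subst sum.atMost_Suc_shift) (simp add: algebra_simps sum.distrib del: fact_Suc)
  \<comment> \<open>Shifting the index back costs nothing, since the new term at 0 carries the
    factor \<open>real 0\<close>; the top term \<open>Suc n\<close> then drops out because
    \<open>Stirling n (Suc n)\<close> is zero.\<close>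
  also have "(\<Sum>k\<le>n. real (Suc k) * real (Stirling n (Suc k)) * ?f (Suc k)) =
      (\<Sum>k\<le>Suc n. real k * real (Stirling n k) * ?f k)"
    by (subst sum.atMost_Suc_shift) simp
  also have "\<dots> = (\<Sum>k\<le>n. real k * real (Stirling n k) * ?f k)"
    by simp
  also have "\<dots> + (\<Sum>k\<le>n. real (Stirling n k) * ?f (Suc k)) =
      z * (\<Sum>k\<le>n. real (Stirling n k) * ?f k)"
    unfolding f_Suc sum.distrib[symmetric] sum_distrib_left
    by (intro sum.cong) (auto simp: algebra_simps)
  also have "\<dots> = z ^ Suc n"
    by (simp only: Suc.IH power_Suc)
  finally show ?case .
qed

lemma sum_gen_stirling2_gbinomial:
  "(\<Sum>l=0..n. gen_stirling2 n l y * (fact l * (z gchoose l))) = (z + y) ^ n"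
proof -
  let ?f = "\<lambda>k. fact k * (z gchoose k) :: real"
  have "(\<Sum>l=0..n. gen_stirling2 n l y * ?f l) =
      (\<Sum>l\<le>n. \<Sum>i\<le>n. real (n choose i) * real (Stirling (n - i) l) * y ^ i * ?f l)"
    by (simp add: gen_stirling2_altdef sum_distrib_right atLeast0AtMost)
  also have "\<dots> = (\<Sum>i\<le>n. \<Sum>l\<le>n. real (n choose i) * real (Stirling (n - i) l) * y ^ i * ?f l)"
    by (rule sum.swap)
  also have "\<dots> = (\<Sum>i\<le>n. real (n choose i) * y ^ i * z ^ (n - i))"
  proof (intro sum.cong refl)
    fix i
    have "(\<Sum>l\<le>n. real (n choose i) * real (Stirling (n - i) l) * y ^ i * ?f l) =
        (\<Sum>l\<le>n - i. real (n choose i) * real (Stirling (n - i) l) * y ^ i * ?f l)"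
      by (intro sum.mono_neutral_right) auto
    also have "\<dots> = real (n choose i) * y ^ i * (\<Sum>l\<le>n - i. real (Stirling (n - i) l) * ?f l)"
      unfolding sum_distrib_left by (intro sum.cong) (auto simp: mult_ac)
    also have "\<dots> = real (n choose i) * y ^ i * z ^ (n - i)"
      by (simp only: sum_Stirling_gbinomial)
    finally show "(\<Sum>l\<le>n. real (n choose i) * real (Stirling (n - i) l) * y ^ i * ?f l) =
        real (n choose i) * y ^ i * z ^ (n - i)" .
  qed
  also have "\<dots> = (y + z) ^ n"
    by (simp add: binomial_ring)
  finally show ?thesis
    by (simp add: add.commute)
qed

section \<open>Bernoulli polynomials through generating functions\<close>

text \<open>E = exp(X) - 1 satisfies E' = E + 1, so the derivative of E^(k+1) is (k+1)(E^(k+1) +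
  E^k). Read coefficientwise, this is the recurrence of the second-kind Stirling numbers.\<close>

lemma fps_nth_exp_minus_one_power:
  "fps_nth ((fps_exp 1 - 1) ^ m) n = fact m * real (Stirling n m) / fact n"
proof (induction n arbitrary: m)
  case 0
  show ?case by (cases m) auto
next
  case (Suc n)
  let ?E = "fps_exp 1 - 1 :: real fps"
  show ?case
  proof (cases m)
    case 0
    then show ?thesis by simp
  next
    case (Suc k)
    have "fps_deriv (?E ^ Suc k) = fps_const (real (Suc k)) * fps_deriv ?E * ?E ^ k"
      by (simp only: fps_deriv_power diff_Suc_1)
    also have "fps_deriv ?E = ?E + 1"
      by simp
    finally have "fps_deriv (?E ^ Suc k) = fps_const (real (Suc k)) * (?E ^ Suc k + ?E ^ k)"
      by (simp only: distrib_left distrib_right power_Suc mult_1_right mult.assoc)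
    then have "fps_nth (fps_deriv (?E ^ Suc k)) n =
        real (Suc k) * (fps_nth (?E ^ Suc k) n + fps_nth (?E ^ k) n)"
      by (simp only: fps_mult_left_const_nth fps_add_nth)
    then have "real (Suc n) * fps_nth (?E ^ Suc k) (Suc n) =
        real (Suc k) * (fact (Suc k) * real (Stirling n (Suc k)) / fact n +
          fact k * real (Stirling n k) / fact n)"
      by (simp only: Suc.IH fps_deriv_nth Suc_eq_plus1)
    also have "\<dots> = fact (Suc k) * real (Stirling (Suc n) (Suc k)) / fact n"
      by (simp add: field_simps)
    finally have "fps_nth (?E ^ Suc k) (Suc n) =
        fact (Suc k) * real (Stirling (Suc n) (Suc k)) / fact n / real (Suc n)"
      by (simp only: nonzero_eq_divide_eq of_nat_eq_0_iff nat.simps mult.commute not_False_eq_True)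
    then show ?thesis
      by (simp only: Suc fact_Suc[of n] of_nat_mult divide_divide_eq_left mult.commute of_nat_Suc)
  qed
qed

lemma fps_nth_exp_mult_exp_minus_one_power:
  "fps_nth (fps_exp x * (fps_exp 1 - 1) ^ m) n = fact m * gen_stirling2 n m x / fact n"
proof -
  have "fps_nth (fps_exp x * (fps_exp 1 - 1) ^ m) n =
      (\<Sum>i\<le>n. x ^ i / fact i * (fact m * real (Stirling (n - i) m) / fact (n - i)))"
    by (simp add: fps_mult_nth fps_nth_exp_minus_one_power atLeast0AtMost)
  also have "\<dots> = (\<Sum>i\<le>n. fact m * (real (n choose i) * real (Stirling (n - i) m) * x ^ i) / fact n)"
    by (intro sum.cong) (auto simp: binomial_fact field_simps)
  also have "\<dots> = fact m * gen_stirling2 n m x / fact n"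
    by (simp add: gen_stirling2_altdef sum_distrib_left sum_divide_distrib)
  finally show ?thesis .
qed

text \<open>The series with coefficients (-1)^m/(m+1) is ln(1+X)/X. Composed with E = exp(X) - 1 and
  multiplied by E it gives X, so both sides agree after multiplication by the nonzero series E,
  which can be cancelled.\<close>

lemma bernoulli_egf_eq:
  "bernoulli_egf x =
    fps_exp x * (Abs_fps (\<lambda>m. (-1) ^ m / real (Suc m)) oo (fps_exp 1 - 1))"
proof -
  let ?E = "fps_exp 1 - 1 :: real fps"
  let ?L = "Abs_fps (\<lambda>m. (-1) ^ m / real (Suc m))"
  have nz: "?E \<noteq> 0" by simp
  have "fps_ln 1 = ?L * fps_X"
    by (intro fps_ext) (auto simp: fps_ln_def)
  then have "(?L oo ?E) * ?E = fps_ln 1 oo ?E"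
    by (simp add: fps_compose_mult_distrib)
  also have "\<dots> = fps_X"
    by (simp add: fps_ln_fps_exp_inv fps_inv_fps_exp_compose)
  finally have "fps_exp x * (?L oo ?E) * ?E = bernoulli_egf x * ?E"
    unfolding bernoulli_egf_mult by (simp add: mult_ac)
  then show ?thesis
    using nz by simp
qed

lemma bernoulli_poly_eq_sum_gen_stirling2:
  "bernoulli_poly n x = (\<Sum>m=0..n. gen_stirling2 n m x * ((-1) ^ m * fact m / real (Suc m)))"
proof -
  let ?E = "fps_exp 1 - 1 :: real fps"
  let ?c = "\<lambda>m. (-1) ^ m / real (Suc m)"
  have "fps_nth (bernoulli_egf x) n =
      (\<Sum>i=0..n. fps_nth (fps_exp x) i * (\<Sum>m=0..n - i. ?c m * fps_nth (?E ^ m) (n - i)))"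
    by (simp only: bernoulli_egf_eq fps_mult_nth fps_compose_nth fps_nth_Abs_fps)
  also have "\<dots> = (\<Sum>i=0..n. \<Sum>m=0..n. ?c m * (fps_nth (fps_exp x) i * fps_nth (?E ^ m) (n - i)))"
  proof (intro sum.cong refl)
    fix i
    \<comment> \<open>E^m has no coefficients below degree \<open>m\<close>, so the range may be
      extended to \<open>n\<close>, making it independent of \<open>i\<close> for the exchange of
      sums.\<close>
    have "(\<Sum>m=0..n - i. ?c m * fps_nth (?E ^ m) (n - i)) =
        (\<Sum>m=0..n. ?c m * fps_nth (?E ^ m) (n - i))"
      by (intro sum.mono_neutral_left) (auto simp: fps_nth_exp_minus_one_power)
    then show "fps_nth (fps_exp x) i * (\<Sum>m=0..n - i. ?c m * fps_nth (?E ^ m) (n - i)) =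
        (\<Sum>m=0..n. ?c m * (fps_nth (fps_exp x) i * fps_nth (?E ^ m) (n - i)))"
      by (simp add: sum_distrib_left mult_ac)
  qed
  also have "\<dots> = (\<Sum>m=0..n. ?c m * fps_nth (fps_exp x * ?E ^ m) n)"
    by (subst sum.swap) (simp only: fps_mult_nth sum_distrib_left)
  also have "\<dots> = (\<Sum>m=0..n. ?c m * (fact m * gen_stirling2 n m x / fact n))"
    by (simp only: fps_nth_exp_mult_exp_minus_one_power)
  finally show ?thesis
    unfolding bernoulli_poly_def by (simp add: sum_distrib_left mult_ac del: of_nat_Suc)
qed

section \<open>Integration over the unit interval and Cauchy polynomials\<close>

lemma integral_power_unit_interval: "integral {0..1} (\<lambda>t::real. t ^ k) = 1 / real (Suc k)"
proof -
  have "((\<lambda>t::real. t ^ k) has_integral 1 ^ Suc k / real (Suc k) - 0 ^ Suc k / real (Suc k)) {0..1}"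
    by (intro fundamental_theorem_of_calculus)
       (auto intro!: derivative_eq_intros simp flip: has_real_derivative_iff_has_vector_derivative
             simp del: of_nat_Suc power_Suc)
  then show ?thesis
    by (simp add: integral_unique)
qed

lemma integral_sum_power_unit_interval:
  fixes a :: "nat \<Rightarrow> real"
  shows "integral {0..1} (\<lambda>t. \<Sum>m=0..n. a m * t ^ m) = (\<Sum>m=0..n. a m / real (Suc m))"
proof -
  have "integral {0..1} (\<lambda>t. \<Sum>m=0..n. a m * t ^ m) =
      (\<Sum>m=0..n. integral {0..1} (\<lambda>t. a m * t ^ m))"
    by (intro integral_sum integrable_continuous_real continuous_intros) auto
  then show ?thesis
    by (simp add: integral_power_unit_interval del: of_nat_Suc)
qed

lemma continuous_on_gbinomial [continuous_intros]:
  fixes f :: "'a::topological_space \<Rightarrow> real"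
  assumes "continuous_on A f"
  shows "continuous_on A (\<lambda>t. f t gchoose k)"
  unfolding gbinomial_prod_rev by (intro continuous_intros assms) auto

text \<open>Termwise integration of the falling factorial expansion of \<open>(f t + y) ^ m\<close>.
  It is meant for \<open>f t = t - y\<close> and \<open>f t = - y - t\<close>, where
  \<open>y\<close> cancels and only a power of \<open>t\<close> or \<open>- t\<close> is left to
  integrate.\<close>

lemma sum_gen_stirling2_integral_gbinomial:
  fixes f :: "real \<Rightarrow> real"
  assumes "continuous_on {0..1} f"
  shows "(\<Sum>l=0..m. gen_stirling2 m l y * (fact l * integral {0..1} (\<lambda>t. f t gchoose l))) =
    integral {0..1} (\<lambda>t. (f t + y) ^ m)"
proof -
  have "integral {0..1} (\<lambda>t. (f t + y) ^ m) =
      integral {0..1} (\<lambda>t. \<Sum>l=0..m. gen_stirling2 m l y * (fact l * (f t gchoose l)))"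
    by (simp only: sum_gen_stirling2_gbinomial)
  also have "\<dots> = (\<Sum>l=0..m. integral {0..1} (\<lambda>t. gen_stirling2 m l y * (fact l * (f t gchoose l))))"
    by (intro integral_sum integrable_continuous_real continuous_intros assms) auto
  finally show ?thesis
    by simp
qed

lemma sum_gen_stirling2_cauchy1:
  "(\<Sum>l=0..m. gen_stirling2 m l y * cauchy1 l y) = 1 / real (Suc m)"
  using sum_gen_stirling2_integral_gbinomial[of "\<lambda>t. t - y" m y]
  by (simp add: cauchy1_def integral_power_unit_interval continuous_intros del: of_nat_Suc)

lemma sum_gen_stirling2_cauchy2:
  "(\<Sum>l=0..m. gen_stirling2 m l y * cauchy2 l (- y)) = (-1) ^ m / real (Suc m)"
proof -
  have "integral {0..1} (\<lambda>t::real. (- t) ^ m) = (-1) ^ m * integral {0..1} (\<lambda>t. t ^ m)"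
    by (subst power_minus) simp
  then show ?thesis
    using sum_gen_stirling2_integral_gbinomial[of "\<lambda>t. - y - t" m y]
    by (simp add: cauchy2_def integral_power_unit_interval continuous_intros del: of_nat_Suc)
qed

text \<open>A falling factorial at \<open>- x - z\<close> is, up to the sign
  \<open>(-1) ^ n\<close>, the rising factorial at \<open>x + z\<close>.\<close>

lemma fact_gbinomial_eq_sum_gen_stirling1:
  "fact n * ((- x - z) gchoose n) = (-1) ^ n * (\<Sum>m=0..n. gen_stirling1 n m x * z ^ m)"
  by (simp add: gbinomial_pochhammer sum_gen_stirling1_power add.commute)

lemma cauchy1_eq_sum_gen_stirling1:
  "cauchy1 n x = (\<Sum>m=0..n. (-1) ^ (n - m) * gen_stirling1 n m x / real (Suc m))"
proof -
  have "fact n * ((t - x) gchoose n) = (\<Sum>m=0..n. ((-1) ^ (n - m) * gen_stirling1 n m x) * t ^ m)"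
    for t :: real
  proof -
    have "fact n * ((t - x) gchoose n) = (-1) ^ n * (\<Sum>m=0..n. gen_stirling1 n m x * (- t) ^ m)"
      using fact_gbinomial_eq_sum_gen_stirling1[of n x "- t"] by simp
    \<comment> \<open>For \<open>m \<le> n\<close> the signs \<open>(-1) ^ n\<close> and
      \<open>(-1) ^ m\<close> combine to \<open>(-1) ^ (n - m)\<close>.\<close>
    also have "\<dots> = (\<Sum>m=0..n. ((-1) ^ (n - m) * gen_stirling1 n m x) * t ^ m)"
      unfolding sum_distrib_left power_minus[of t]
      by (intro sum.cong) (auto simp: uminus_power_if mult_ac)
    finally show ?thesis .
  qed
  then have "cauchy1 n x =
      integral {0..1} (\<lambda>t. \<Sum>m=0..n. ((-1) ^ (n - m) * gen_stirling1 n m x) * t ^ m)"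
    unfolding cauchy1_def by (simp flip: integral_mult_right)
  then show ?thesis
    by (simp only: integral_sum_power_unit_interval)
qed

lemma cauchy2_eq_sum_gen_stirling1:
  "cauchy2 n (- x) = (\<Sum>m=0..n. (-1) ^ n * gen_stirling1 n m x / real (Suc m))"
proof -
  have "fact n * ((- x - t) gchoose n) = (\<Sum>m=0..n. ((-1) ^ n * gen_stirling1 n m x) * t ^ m)"
    for t :: real
    unfolding fact_gbinomial_eq_sum_gen_stirling1 by (simp add: sum_distrib_left mult_ac)
  then have "cauchy2 n (- x) =
      integral {0..1} (\<lambda>t. \<Sum>m=0..n. ((-1) ^ n * gen_stirling1 n m x) * t ^ m)"
    unfolding cauchy2_def by (simp flip: integral_mult_right)
  then show ?thesis
    by (simp only: integral_sum_power_unit_interval)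
qed

section \<open>Orthogonality and inversion\<close>

text \<open>Evaluation at \<open>j = k\<close> kills all binomials with lower index above
  \<open>k\<close> and leaves coefficient 1 at \<open>k\<close>. The system is unitriangular and is
  solved by strong induction.\<close>

lemma binomial_coeffs_unique:
  fixes a b :: "nat \<Rightarrow> real"
  assumes "\<And>j. (\<Sum>k=0..N. a k * real (j choose k)) = (\<Sum>k=0..N. b k * real (j choose k))"
    and "k \<le> N"
  shows "a k = b k"
  using \<open>k \<le> N\<close>
proof (induction k rule: less_induct)
  case (less k)
  have split: "(\<Sum>i=0..N. c i * real (k choose i)) = (\<Sum>i<k. c i * real (k choose i)) + c k"
    for c :: "nat \<Rightarrow> real"
  proof -
    have "(\<Sum>i=0..N. c i * real (k choose i)) = (\<Sum>i\<le>k. c i * real (k choose i))"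
      using less.prems by (intro sum.mono_neutral_right) auto
    then show ?thesis
      by (simp flip: lessThan_Suc_atMost)
  qed
  have "(\<Sum>i<k. a i * real (k choose i)) = (\<Sum>i<k. b i * real (k choose i))"
    using less by (intro sum.cong) auto
  then show ?case
    using assms(1)[of k] by (simp add: split)
qed

lemma sum_triangle_swap:
  fixes f :: "nat \<Rightarrow> nat \<Rightarrow> 'a::comm_monoid_add"
  shows "(\<Sum>l=0..m. \<Sum>k=0..l. f l k) = (\<Sum>k=0..m. \<Sum>l=k..m. f l k)"
  unfolding sum.Sigma[OF finite_atLeastAtMost ballI[OF finite_atLeastAtMost]]
  by (rule sum.reindex_bij_witness[of _ prod.swap prod.swap]) auto

text \<open>Both sides are compared as coefficients in the basis \<open>j choose k\<close>. Weighted
  with \<open>fact k * (j choose k)\<close> and summed over \<open>k\<close>, the second-kind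
  numbers collapse to \<open>(j + y) ^ l\<close>; the first-kind numbers, taken at
  \<open>z = - (j + y)\<close>, then give \<open>pochhammer (- j) m\<close>, which is a multiple of
  \<open>j choose m\<close> alone.\<close>

lemma gen_stirling_orthogonal:
  assumes "k \<le> m"
  shows "(\<Sum>l=k..m. (-1) ^ l * gen_stirling1 m l y * gen_stirling2 l k y) =
    (if k = m then (-1) ^ m else 0)"
proof -
  define A where "A k = (\<Sum>l=k..m. (-1) ^ l * gen_stirling1 m l y * gen_stirling2 l k y)" for k
  have "(\<Sum>k=0..m. (A k * fact k) * real (j choose k)) =
      (\<Sum>k=0..m. (if k = m then (-1) ^ m * fact m else 0) * real (j choose k))" for j
  proof -
    have "(\<Sum>k=0..m. (A k * fact k) * real (j choose k)) =
        (\<Sum>k=0..m. \<Sum>l=k..m. (-1) ^ l * gen_stirling1 m l y *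
          (gen_stirling2 l k y * (fact k * (real j gchoose k))))"
      by (simp add: A_def sum_distrib_left sum_distrib_right mult_ac binomial_gbinomial)
    also have "\<dots> = (\<Sum>l=0..m. \<Sum>k=0..l. (-1) ^ l * gen_stirling1 m l y *
          (gen_stirling2 l k y * (fact k * (real j gchoose k))))"
      by (rule sum_triangle_swap[symmetric])
    also have "\<dots> = (\<Sum>l=0..m. (-1) ^ l * gen_stirling1 m l y * (real j + y) ^ l)"
      by (simp only: sum_gen_stirling2_gbinomial flip: sum_distrib_left)
    \<comment> \<open>The alternating sign is absorbed into the base, so that the shift
      \<open>y\<close> cancels in the rising factorial.\<close>
    also have "\<dots> = (\<Sum>l=0..m. gen_stirling1 m l y * (- (real j + y)) ^ l)"
      by (subst power_minus) (simp add: mult_ac)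
    also have "\<dots> = pochhammer (- real j) m"
      unfolding sum_gen_stirling1_power by simp
    also have "\<dots> = (-1) ^ m * fact m * (real j gchoose m)"
      by (simp add: gbinomial_pochhammer)
    finally show ?thesis
      by (simp add: binomial_gbinomial if_distrib[of "\<lambda>c. c * _"] cong: if_cong)
  qed
  from binomial_coeffs_unique[OF this assms]
  have "A k * fact k = (if k = m then (-1) ^ m else 0) * fact k"
    by simp
  then show ?thesis
    unfolding A_def by simp
qed

lemma sum_gen_stirling1_bernoulli_poly:
  "(\<Sum>l=0..m. (-1) ^ l * gen_stirling1 m l y * bernoulli_poly l y) = fact m / real (Suc m)"
proof -
  let ?b = "\<lambda>k. (-1) ^ k * fact k / real (Suc k)"
  have "(\<Sum>l=0..m. (-1) ^ l * gen_stirling1 m l y * bernoulli_poly l y) =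
      (\<Sum>l=0..m. \<Sum>k=0..l. (-1) ^ l * gen_stirling1 m l y * gen_stirling2 l k y * ?b k)"
    by (simp only: bernoulli_poly_eq_sum_gen_stirling2 sum_distrib_left mult.assoc)
  also have "\<dots> = (\<Sum>k=0..m. \<Sum>l=k..m. (-1) ^ l * gen_stirling1 m l y * gen_stirling2 l k y * ?b k)"
    by (rule sum_triangle_swap)
  also have "\<dots> = (\<Sum>k=0..m. (if k = m then (-1) ^ m else 0) * ?b k)"
    by (intro sum.cong refl) (simp only: gen_stirling_orthogonal atLeastAtMost_iff flip: sum_distrib_right)
  \<comment> \<open>At the surviving index \<open>k = m\<close> the sign from orthogonality cancels
    the sign in \<open>?b m\<close>.\<close>
  also have "\<dots> = (\<Sum>k=0..m. if k = m then fact m / real (Suc m) else 0)"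
    by (intro sum.cong) (auto simp flip: power_add)
  finally show ?thesis
    by simp
qed

section \<open>The four double-sum identities, by evaluating the inner sums\<close>

theorem proposition4:
  fixes n :: nat and x y :: real
  shows "bernoulli_poly n x =
      (\<Sum>m = 0..n. \<Sum>l = 0..m.
        (-1) ^ m * fact m * gen_stirling2 n m x * gen_stirling2 m l y * cauchy1 l y) \<and>
    bernoulli_poly n x =
      (\<Sum>m = 0..n. \<Sum>l = 0..m.
        fact m * gen_stirling2 n m x * gen_stirling2 m l y * cauchy2 l (- y)) \<and>
    cauchy1 n x =
      (\<Sum>m = 0..n. \<Sum>l = 0..m.
        (-1) ^ (n - m + l) / fact m * gen_stirling1 n m x * gen_stirling1 m l y * bernoulli_poly l y) \<and>
    cauchy2 n (- x) =
      (\<Sum>m = 0..n. \<Sum>l = 0..m.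
        (-1) ^ (n - l) / fact m * gen_stirling1 n m x * gen_stirling1 m l y * bernoulli_poly l y)"
proof (intro conjI)
  have "(\<Sum>m=0..n. \<Sum>l=0..m.
        (-1) ^ m * fact m * gen_stirling2 n m x * gen_stirling2 m l y * cauchy1 l y) =
      (\<Sum>m=0..n. (-1) ^ m * fact m * gen_stirling2 n m x *
        (\<Sum>l=0..m. gen_stirling2 m l y * cauchy1 l y))"
    by (simp only: sum_distrib_left mult.assoc)
  also have "\<dots> = bernoulli_poly n x"
    unfolding sum_gen_stirling2_cauchy1 bernoulli_poly_eq_sum_gen_stirling2
    by (intro sum.cong) auto
  finally show "bernoulli_poly n x = (\<Sum>m=0..n. \<Sum>l=0..m.
      (-1) ^ m * fact m * gen_stirling2 n m x * gen_stirling2 m l y * cauchy1 l y)" ..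
next
  have "(\<Sum>m=0..n. \<Sum>l=0..m.
        fact m * gen_stirling2 n m x * gen_stirling2 m l y * cauchy2 l (- y)) =
      (\<Sum>m=0..n. fact m * gen_stirling2 n m x *
        (\<Sum>l=0..m. gen_stirling2 m l y * cauchy2 l (- y)))"
    by (simp only: sum_distrib_left mult.assoc)
  also have "\<dots> = bernoulli_poly n x"
    unfolding sum_gen_stirling2_cauchy2 bernoulli_poly_eq_sum_gen_stirling2
    by (intro sum.cong) auto
  finally show "bernoulli_poly n x = (\<Sum>m=0..n. \<Sum>l=0..m.
      fact m * gen_stirling2 n m x * gen_stirling2 m l y * cauchy2 l (- y))" ..
next
  have "(\<Sum>m=0..n. \<Sum>l=0..m.
        (-1) ^ (n - m + l) / fact m * gen_stirling1 n m x * gen_stirling1 m l y * bernoulli_poly l y) =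
      (\<Sum>m=0..n. (-1) ^ (n - m) / fact m * gen_stirling1 n m x *
        (\<Sum>l=0..m. (-1) ^ l * gen_stirling1 m l y * bernoulli_poly l y))"
    unfolding sum_distrib_left by (intro sum.cong refl) (simp only: power_add divide_inverse mult_ac)
  also have "\<dots> = cauchy1 n x"
    unfolding sum_gen_stirling1_bernoulli_poly cauchy1_eq_sum_gen_stirling1
    by (intro sum.cong) auto
  finally show "cauchy1 n x = (\<Sum>m=0..n. \<Sum>l=0..m.
      (-1) ^ (n - m + l) / fact m * gen_stirling1 n m x * gen_stirling1 m l y * bernoulli_poly l y)" ..
next
  have "(\<Sum>m=0..n. \<Sum>l=0..m.
        (-1) ^ (n - l) / fact m * gen_stirling1 n m x * gen_stirling1 m l y * bernoulli_poly l y) =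
      (\<Sum>m=0..n. (-1) ^ n / fact m * gen_stirling1 n m x *
        (\<Sum>l=0..m. (-1) ^ l * gen_stirling1 m l y * bernoulli_poly l y))"
    \<comment> \<open>Since \<open>l \<le> m \<le> n\<close>, the number \<open>n - l\<close> has
      the parity of \<open>n + l\<close>, so the sign splits into \<open>(-1) ^ n\<close> and
      \<open>(-1) ^ l\<close>.\<close>
    unfolding sum_distrib_left by (intro sum.cong) (auto simp: uminus_power_if)
  also have "\<dots> = cauchy2 n (- x)"
    unfolding sum_gen_stirling1_bernoulli_poly cauchy2_eq_sum_gen_stirling1
    by (intro sum.cong) auto
  finally show "cauchy2 n (- x) = (\<Sum>m=0..n. \<Sum>l=0..m.
      (-1) ^ (n - l) / fact m * gen_stirling1 n m x * gen_stirling1 m l y * bernoulli_poly l y)" ..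
qed

end
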